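(* Let $a<b$ be real numbers and let $\mathcal I$ be a set of subintervals of $[a,b]$. Suppose that $\mathcal I$ satisfies the following three conditions: (A) for all $s,t$ with $a<s<t\le b$: if $[a,s]\in\mathcal I$ and $[s,t]\in\mathcal I$, then $[a,t]\in\mathcal I$; (L) for every $s\in(a,b]$ there exists $r$ with $a\le r<s$ such that $[x,s]\in\mathcal I$ for all $x$ with $r\le x<s$; (r) for every $s\in[a,b)$ there exists $t$ with $s<t\le b$ such that $[s,t]\in\mathcal I$. Then $[a,b]\in\mathcal I$.
   Context: Intervals are intervals of the real line $\mathbb R$. *)

theory Defs
  imports "HOL-Analysis.Analysis"
begin

end

theory Submission
  imports Defs
begin

text \<open>A supremum argument (real induction). Let \<open>m\<close> be the supremum of the right
  endpoints \<open>s > a\<close> reachable from \<open>a\<close>, meaning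
  \<open>{a..s} \<in> I\<close>. Condition L at \<open>m\<close> lets a reachable point close to
  \<open>m\<close> be joined to \<open>m\<close> by A, so the supremum is itself reachable. If
  \<open>m < b\<close>, condition r at \<open>m\<close> followed by A reaches a point beyond
  \<open>m\<close>, a contradiction.\<close>

theorem mainTheorem1:
  fixes a b :: real and I :: "real set set"
  assumes "a < b"
    and subintervals: "\<And>J. J \<in> I \<Longrightarrow> is_interval J \<and> J \<subseteq> {a..b}"
    and A: "\<And>s t. a < s \<Longrightarrow> s < t \<Longrightarrow> t \<le> b \<Longrightarrow> {a..s} \<in> I \<Longrightarrow> {s..t} \<in> I \<Longrightarrow> {a..t} \<in> I"
    and L: "\<And>s. s \<in> {a<..b} \<Longrightarrow> \<exists>r. a \<le> r \<and> r < s \<and> (\<forall>x. r \<le> x \<and> x < s \<longrightarrow> {x..s} \<in> I)"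
    and r: "\<And>s. s \<in> {a..<b} \<Longrightarrow> \<exists>t. s < t \<and> t \<le> b \<and> {s..t} \<in> I"
  shows "{a..b} \<in> I"
proof -
  define S where "S = {s. a < s \<and> s \<le> b \<and> {a..s} \<in> I}"
  define m where "m = Sup S"
  have bdd: "bdd_above S"
    by (auto simp: S_def intro: bdd_aboveI)
  \<comment> \<open>Condition r at \<open>a\<close> starts the process; it also forces
    \<open>a < m\<close>, without which neither L nor A could be applied at
    \<open>m\<close>.\<close>
  obtain s0 where s0: "s0 \<in> S"
    using r[of a] \<open>a < b\<close> by (auto simp: S_def)
  have m_upper: "s \<le> m" if "s \<in> S" for s
    unfolding m_def using that bdd by (rule cSup_upper)
  have "m \<le> b"
    unfolding m_def using s0 by (intro cSup_least) (auto simp: S_def)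
  have "a < m"
    using s0 m_upper[OF s0] by (simp add: S_def)
  obtain q where "q < m" and q: "\<And>x. q \<le> x \<Longrightarrow> x < m \<Longrightarrow> {x..m} \<in> I"
    using L[of m] \<open>a < m\<close> \<open>m \<le> b\<close> by auto
  \<comment> \<open>Only \<open>q < s\<close> is known about \<open>s\<close>, so the uniformity of
    L in the left endpoint is essential here.\<close>
  obtain s where s: "s \<in> S" "q < s"
    using less_cSupD[of S q] s0 \<open>q < m\<close> by (auto simp: m_def)
  have m: "{a..m} \<in> I"
  \<comment> \<open>A joins nondegenerate intervals only, so a supremum already attained by
    \<open>s\<close> is treated separately.\<close>
  proof (cases "s = m")
    case True
    then show ?thesis using s by (simp add: S_def)
  next
    case False
    then have "s < m" using m_upper[OF s(1)] by simp
    then show ?thesis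
      using A[of s m] q[of s] s \<open>m \<le> b\<close> by (simp add: S_def)
  qed
  have "m = b"
  proof (rule ccontr)
    assume "m \<noteq> b"
    then obtain t where t: "m < t" "t \<le> b" "{m..t} \<in> I"
      using r[of m] \<open>a < m\<close> \<open>m \<le> b\<close> by auto
    then have "t \<in> S"
      using A[of m t] m \<open>a < m\<close> by (simp add: S_def)
    then show False
      using m_upper[of t] t by simp
  qed
  with m show ?thesis by simp
qed

end
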